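(* If $a\in(0,1)\setminus\mathcal{P}$, then there exists $f\in\mathcal{F}$ such that $a\in H(f)$ and $a$ is an isolated point of $H(f)$.
   Context: $\mathbb{N}$ denotes the set of positive integers, and $\mathcal{P}:=\{0\}\cup\{\frac{1}{n} : n\in\mathbb{N}\}$. $\mathcal{F}$ denotes the class of all continuous functions $f:[0,1]\to\mathbb{R}$ with $f(0)=f(1)=0$. For $f\in\mathcal{F}$, the set of chords of $f$ is $$H(f):=\{\ell\in[0,1] : f(x-\ell)=f(x)\ \text{for some}\ x\in[\ell,1]\}.$$ A point $p$ of a set $S\subset\mathbb{R}$ is isolated in $S$ if $p\in S$ and there is $\varepsilon>0$ with $S\cap(p-\varepsilon,p+\varepsilon)=\{p\}$. *)

theory Defs
  imports "HOL-Analysis.Analysis"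
begin

definition unit_fractions0 :: "real set" where
  "unit_fractions0 = {0} \<union> {1 / real n | n :: nat. n \<ge> 1}"

text \<open>
  Functions on the unit interval are represented by total functions on the reals;
  both definitions below depend only on the values on \<open>{0..1}\<close>.
\<close>

definition chord_functions :: "(real \<Rightarrow> real) set" where
  "chord_functions = {f. continuous_on {0..1} f \<and> f 0 = 0 \<and> f 1 = 0}"

definition chords :: "(real \<Rightarrow> real) \<Rightarrow> real set" where
  "chords f = {l \<in> {0..1}. \<exists>x\<in>{l..1}. f (x - l) = f x}"

end

theory Submission
  imports Defs
begin

text \<open>
  Write a chord of length \<open>l\<close> close to \<open>a\<close> as a pair of points \<open>v\<close> and \<open>a + u\<close> with
  \<open>v \<ge> 0\<close> and \<open>l - a = u - v\<close>. The chord length \<open>a\<close> is isolated as soon as \<open>f\<close>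
  increases strictly over every step of length \<open>a\<close> except the one from \<open>0\<close> to \<open>a\<close>, while
  \<open>f\<close> has a strict local maximum at \<open>0\<close> and a strict local minimum at \<open>a\<close> of the same
  height: chords far from \<open>(0, a)\<close> are excluded by the strict increase, and near \<open>(0, a)\<close> the
  inequalities \<open>f v \<le> 0 \<le> f (a + u)\<close> leave only \<open>u = v = 0\<close>.

  A piecewise linear function \<open>d\<close> with these properties is easily drawn, with corners at \<open>0\<close>
  and \<open>a\<close>; what it misses is the boundary condition at \<open>1\<close>. As in Levy's proof that
  \<open>1 / n\<close> are the only universal chord lengths, this is repaired by subtracting a multiple of an
  \<open>a\<close>-periodic function \<open>p\<close> with \<open>p 0 = 0\<close>, which does not change the increments over steps
  of length \<open>a\<close>. It is possible exactly because \<open>1 / a\<close> is not an integer, so that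
  \<open>p 1 \<noteq> 0\<close>. The choice \<open>p x = (sin (\<pi> x / a))\<^sup>2\<close> vanishes to second order
  at the multiples of \<open>a\<close>, so no multiple of it, however large, can destroy
  the linear corners of \<open>d\<close>.
\<close>

text \<open>
  For \<open>x \<ge> 0\<close> the graph is the polygon through \<open>(0, 0)\<close>, \<open>(a/3, -a/3)\<close>,
  \<open>(2a/3, a/3)\<close>, \<open>(a, 0)\<close>, which continues with slope \<open>1\<close>; in this form all its
  inequalities are decided by linear arithmetic.
\<close>

definition zigzag :: "real \<Rightarrow> real \<Rightarrow> real" where
  "zigzag a x = max (- x) (min (2 * x - a) \<bar>x - a\<bar>)"

lemma continuous_on_zigzag: "continuous_on S (zigzag a)"
  unfolding zigzag_def by (intro continuous_intros)

lemma zigzag_near_0: "a > 0 \<Longrightarrow> 0 \<le> v \<Longrightarrow> v \<le> a / 3 \<Longrightarrow> zigzag a v = - v"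
  unfolding zigzag_def by (simp add: max_def min_def abs_if)

lemma zigzag_near_period: "a > 0 \<Longrightarrow> \<bar>u\<bar> \<le> a / 3 \<Longrightarrow> zigzag a (a + u) = \<bar>u\<bar>"
  unfolding zigzag_def by (simp add: max_def min_def abs_if split: if_splits)

text \<open>
  The minimum bounds the increment over the step from \<open>v\<close> to \<open>a + v\<close>, which thus vanishes
  only for \<open>v = 0\<close>. All slopes have absolute value at most \<open>2\<close>, so moving the right end
  to \<open>a + u\<close> costs at most \<open>2 * \<bar>u - v\<bar>\<close>.
\<close>

lemma zigzag_increment:
  assumes "a > 0" "v \<ge> 0"
  shows "min (2 * v) (a / 3) - 2 * \<bar>u - v\<bar> \<le> zigzag a (a + u) - zigzag a v"
  using assms unfolding zigzag_def by (simp add: max_def min_def abs_if)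

lemma abs_sin_squared_diff_le:
  fixes x y :: real
  shows "\<bar>(sin x)\<^sup>2 - (sin y)\<^sup>2\<bar> \<le> \<bar>x + y\<bar> * \<bar>x - y\<bar>"
proof -
  have "(sin x)\<^sup>2 - (sin y)\<^sup>2 = (sin x)\<^sup>2 * (1 - (sin y)\<^sup>2) - (1 - (sin x)\<^sup>2) * (sin y)\<^sup>2"
    by (simp add: algebra_simps)
  also have "\<dots> = (sin x)\<^sup>2 * (cos y)\<^sup>2 - (cos x)\<^sup>2 * (sin y)\<^sup>2"
    by (simp add: cos_squared_eq)
  also have "\<dots> = sin (x + y) * sin (x - y)"
    by (simp add: sin_add sin_diff power2_eq_square algebra_simps)
  finally show ?thesis
    by (simp add: abs_mult mult_mono abs_sin_x_le_abs_x)
qed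

text \<open>
  This is what makes the boundary condition at \<open>1\<close> attainable: a zero of the sine
  would make \<open>1 / a\<close> an integer.
\<close>

lemma sin_pi_over_nonzero:
  fixes a :: real
  assumes "a > 0" "a \<notin> unit_fractions0"
  shows "sin (pi / a) \<noteq> 0"
proof
  assume "sin (pi / a) = 0"
  then obtain i :: int where i: "pi / a = of_int i * pi"
    by (auto simp: sin_zero_iff_int2)
  then have inv: "1 = of_int i * a"
    using \<open>a > 0\<close> by (simp add: field_simps)
  with \<open>a > 0\<close> have "i > 0"
    by (metis of_int_0_less_iff zero_less_mult_pos2 zero_less_one)
  then have "real (nat i) = of_int i" "nat i \<ge> 1"
    by auto
  moreover from this inv have "a = 1 / real (nat i)"
    using \<open>i > 0\<close> by (simp add: field_simps)
  ultimately show False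
    using assms unfolding unit_fractions0_def by blast
qed

text \<open>
  Two-stage estimate: the increment of the polygon first forces \<open>v\<close>, hence \<open>u\<close>, to be of the
  order of \<open>\<bar>u - v\<bar>\<close>. There the corners of the polygon contribute \<open>\<bar>u\<bar> + v\<close>, while the
  perturbation contributes at most the small factor \<open>C * \<bar>u - v\<bar>\<close> times this.
  The radius \<open>a / (12 * (C + 1))\<close> keeps \<open>u\<close> and \<open>v\<close> within the range \<open>a / 3\<close> of the two
  corners, and that factor below \<open>1\<close>.
\<close>

lemma zigzag_perturbed_increment_eq_0:
  assumes "0 < a" "a < 1" "C \<ge> 0" "0 \<le> v" "v \<le> 1" "\<bar>u\<bar> \<le> 1"
    and close: "\<bar>u - v\<bar> < a / (12 * (C + 1))"
    and incr: "zigzag a (a + u) - zigzag a v \<le> C * \<bar>u + v\<bar> * \<bar>u - v\<bar>"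
  shows "u = 0 \<and> v = 0"
proof -
  define \<delta> where "\<delta> = \<bar>u - v\<bar>"
  have small: "12 * (C * \<delta> + \<delta>) < a"
    using close \<open>C \<ge> 0\<close> by (simp add: \<delta>_def field_simps)
  have "0 \<le> C * \<delta>" "0 \<le> \<delta>"
    using \<open>C \<ge> 0\<close> by (auto simp: \<delta>_def)
  have perturb: "C * \<bar>u + v\<bar> * \<delta> = (C * \<delta>) * \<bar>u + v\<bar>"
    by simp
  have "\<dots> \<le> (C * \<delta>) * 2"
    using assms \<open>0 \<le> C * \<delta>\<close> by (intro mult_left_mono) auto
  then have "min (2 * v) (a / 3) \<le> 2 * (C * \<delta> + \<delta>)"
    using zigzag_increment[OF \<open>0 < a\<close> \<open>0 \<le> v\<close>, of u] incr perturb
    unfolding \<delta>_def by argo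
  then have v: "v \<le> a / 12"
    using small \<open>0 < a\<close> by (simp add: min_def split: if_splits)
  have "\<bar>u\<bar> \<le> v + \<delta>"
    using \<open>0 \<le> v\<close> unfolding \<delta>_def by linarith
  then have "\<bar>u\<bar> \<le> a / 3"
    using v small \<open>0 \<le> C * \<delta>\<close> \<open>0 \<le> \<delta>\<close> by argo
  then have "\<bar>u\<bar> + v \<le> (C * \<delta>) * \<bar>u + v\<bar>"
    using v incr zigzag_near_0[of a v] zigzag_near_period[of a u] \<open>0 < a\<close> \<open>0 \<le> v\<close>
    by (simp add: \<delta>_def ac_simps)
  also have "\<dots> \<le> (1 / 2) * (\<bar>u\<bar> + v)"
    using small \<open>a < 1\<close> \<open>0 \<le> C * \<delta>\<close> \<open>0 \<le> \<delta>\<close> \<open>0 \<le> v\<close> by (intro mult_mono) auto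
  finally show ?thesis
    using \<open>0 \<le> v\<close> by auto
qed

theorem theorem5:
  fixes a :: real
  assumes "a \<in> {0<..<1} - unit_fractions0"
  shows "\<exists>f\<in>chord_functions. a \<in> chords f \<and> a isolated_in chords f"
proof -
  have a: "0 < a" "a < 1" "sin (pi / a) \<noteq> 0"
    using assms sin_pi_over_nonzero[of a] by auto
  define p where "p x = (sin (pi * x / a))\<^sup>2" for x
  define K where "K = zigzag a 1 / p 1"
  define f where "f x = zigzag a x - K * p x" for x
  define C where "C = \<bar>K\<bar> * (pi / a)\<^sup>2"
  define \<epsilon> where "\<epsilon> = a / (12 * (C + 1))"
  have "C \<ge> 0"
    by (simp add: C_def)
  then have "\<epsilon> > 0"
    using a by (simp add: \<epsilon>_def)
  have p_period: "p (a + u) = p u" for u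
    using a by (simp add: p_def distrib_left add_divide_distrib sin_add)
  have p_diff: "\<bar>K * (p u - p v)\<bar> \<le> C * \<bar>u + v\<bar> * \<bar>u - v\<bar>" for u v
  proof -
    have "\<bar>p u - p v\<bar> \<le> \<bar>pi * u / a + pi * v / a\<bar> * \<bar>pi * u / a - pi * v / a\<bar>"
      unfolding p_def by (rule abs_sin_squared_diff_le)
    also have "pi * u / a + pi * v / a = (pi / a) * (u + v)"
      by (simp add: distrib_left add_divide_distrib)
    also have "pi * u / a - pi * v / a = (pi / a) * (u - v)"
      by (simp add: right_diff_distrib diff_divide_distrib)
    also have "\<bar>(pi / a) * (u + v)\<bar> * \<bar>(pi / a) * (u - v)\<bar> = (pi / a)\<^sup>2 * \<bar>u + v\<bar> * \<bar>u - v\<bar>"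
      using a by (simp add: abs_mult power2_eq_square)
    finally have "\<bar>K\<bar> * \<bar>p u - p v\<bar> \<le> \<bar>K\<bar> * ((pi / a)\<^sup>2 * \<bar>u + v\<bar> * \<bar>u - v\<bar>)"
      by (intro mult_left_mono) auto
    then show ?thesis
      by (simp add: C_def abs_mult mult.assoc)
  qed
  have "f 0 = 0"
    using a zigzag_near_0[of a 0] by (simp add: f_def p_def)
  moreover have "f 1 = 0"
    using a by (simp add: f_def K_def p_def)
  moreover have "continuous_on {0..1} f"
    unfolding f_def p_def
    by (intro continuous_intros continuous_on_zigzag) (use a in auto)
  ultimately have "f \<in> chord_functions"
    by (simp add: chord_functions_def)
  moreover have a_chord: "a \<in> chords f"
  proof -
    have "f a = 0"
      using a zigzag_near_period[of a 0] p_period[of 0] by (simp add: f_def p_def)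
    then have "f (a - a) = f a"
      using \<open>f 0 = 0\<close> by simp
    then show ?thesis
      using a by (auto simp: chords_def intro!: bexI[of _ a])
  qed
  moreover have "a isolated_in chords f"
  proof -
    have "l = a" if l: "l \<in> ball a \<epsilon>" "l \<in> chords f" for l
    proof -
      obtain x where x: "l \<in> {0..1}" "x \<in> {l..1}" "f (x - l) = f x"
        using l(2) unfolding chords_def by blast
      define u where "u = x - a"
      define v where "v = x - l"
      have uv: "l = a + (u - v)"
        by (simp add: u_def v_def)
      have "f v = f (a + u)"
        using x by (simp add: u_def v_def)
      then have "zigzag a (a + u) - zigzag a v = K * (p u - p v)"
        by (simp add: f_def p_period algebra_simps)
      then have "zigzag a (a + u) - zigzag a v \<le> C * \<bar>u + v\<bar> * \<bar>u - v\<bar>"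
        using p_diff[of u v] by linarith
      moreover have "\<bar>u - v\<bar> < a / (12 * (C + 1))"
        using l by (simp add: u_def v_def \<epsilon>_def dist_real_def abs_minus_commute)
      ultimately have "u = 0 \<and> v = 0"
        using a x \<open>C \<ge> 0\<close>
        by (intro zigzag_perturbed_increment_eq_0[of a C]) (auto simp: u_def v_def)
      then show ?thesis
        by (simp add: uv)
    qed
    then have "ball a \<epsilon> \<inter> chords f = {a}"
      using a_chord \<open>\<epsilon> > 0\<close> by auto
    then show ?thesis
      unfolding isolated_in_def using a_chord by blast
  qed
  ultimately show ?thesis
    by blast
qed

end
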